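(* Let $\mathcal{V}$ be a finite ground set, let $k\ge 2$ and $1\le\tau\le k$ be integers with $|\mathcal{V}|\ge k$, and let $h:\mathcal{H}(\mathcal{V})\to\mathbb{R}_{\ge 0}$ with $h(())=0$ be forward-monotone, backward-monotone and sequence-submodular. Let $S$ be the sequence output by Algorithm 1 with parameters $k,\tau$, and let $\mathrm{OPT}_\tau=\max_{S'\in\mathcal{H}(\mathcal{V}),\,|S'|\le k}\ \min_{\mathcal{V}'\subseteq\mathcal{V}(S'),\,|\mathcal{V}'|\le \tau} h(S'-\mathcal{V}')$. Then for every set $\mathcal{Z}\subseteq\mathcal{V}(S)$ of exactly $\tau$ elements occupying $\tau$ consecutive positions of $S$, $$h(S-\mathcal{Z})\ge \frac{(e-1)^2}{e(2e-1)}\,\mathrm{OPT}_\tau,$$ and, if moreover $\tau<k$, $$h(S-\mathcal{Z})\ge \frac{(e-1)\big(e^{\frac{k-2\tau}{k-\tau}}-1\big)}{(2e-1)e^{\frac{k-2\tau}{k-\tau}}-(e-1)}\,\mathrm{OPT}_\tau.$$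
   Context: $\mathcal{H}(\mathcal{V})$ denotes the set of all finite sequences $(v_1,\dots,v_m)$ of pairwise distinct elements of $\mathcal{V}$ ($0\le m\le|\mathcal{V}|$), including the empty sequence $()$. For $S\in\mathcal{H}(\mathcal{V})$, $\mathcal{V}(S)$ is the set of its elements and $|S|=|\mathcal{V}(S)|$. For a set $\mathcal{U}$, $S-\mathcal{U}$ is the sequence obtained from $S$ by deleting the elements of $\mathcal{U}$ and keeping the order of the remaining elements. For $S_1=(v_1,\dots,v_{m_1})$ and $S_2\in\mathcal{H}(\mathcal{V})$ with $S_2-\mathcal{V}(S_1)=(w_1,\dots,w_{m_3})$, the concatenation is $S_1\oplus S_2=(v_1,\dots,v_{m_1},w_1,\dots,w_{m_3})$. Write $S_1\preceq S_2$ if $S_2=S_1\oplus S_3$ for some $S_3\in\mathcal{H}(\mathcal{V})$. Marginal value: $h(S_2\mid S_1)=h(S_1\oplus S_2)-h(S_1)$; $(v)$ is the one-element sequence. $h$ is forward-monotone if $h(S_1\oplus S_2)\ge h(S_1)$ for all $S_1,S_2$; backward-monotone if $h(S_1\oplus S_2)\ge h(S_2)$ for all $S_1,S_2$; sequence-submodular if $h(S_3\mid S_1)\ge h(S_3\mid S_2)$ for all $S_3$ and all $S_1\preceq S_2$. Algorithm 1 (parameters $k$, $\tau$): Step 1: start with $S_1=()$ and, while $|S_1|<\tau$, set $S_1=S_1\oplus(v)$ with $v\in\arg\max_{v\in\mathcal{V}\setminus\mathcal{V}(S_1)}h((v)\mid S_1)$. Step 2: start with $S_2=()$ and, while $|S_2|<k-\tau$,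 set $S_2=S_2\oplus(v)$ with $v\in\arg\max_{v\in\mathcal{V}\setminus(\mathcal{V}(S_1)\cup\mathcal{V}(S_2))}h((v)\mid S_2)$. Output $S=S_1\oplus S_2$. Ties are broken arbitrarily.
   Formalization: The second bound is proved only when its denominator (2e-1)e^{(k-2τ)/(k-τ)}-(e-1) is positive (automatic for 2τ≤k); when it is negative the ratio exceeds 1 and the bound is false, e.g. k=3, τ=2, h(S)=|S|. *)

theory Defs
  imports Complex_Main
begin

definition seqs :: "'a set \<Rightarrow> 'a list set" where
  "seqs V = {S. distinct S \<and> set S \<subseteq> V}"

definition seq_minus :: "'a list \<Rightarrow> 'a set \<Rightarrow> 'a list" (infixl "\<ominus>" 65) where
  "S \<ominus> U = filter (\<lambda>v. v \<notin> U) S"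

definition seq_concat :: "'a list \<Rightarrow> 'a list \<Rightarrow> 'a list" (infixl "\<oplus>" 65) where
  "S\<^sub>1 \<oplus> S\<^sub>2 = S\<^sub>1 @ (S\<^sub>2 \<ominus> set S\<^sub>1)"

definition seq_prefix :: "'a set \<Rightarrow> 'a list \<Rightarrow> 'a list \<Rightarrow> bool" where
  "seq_prefix V S\<^sub>1 S\<^sub>2 \<longleftrightarrow> (\<exists>S\<^sub>3 \<in> seqs V. S\<^sub>2 = S\<^sub>1 \<oplus> S\<^sub>3)"

text \<open>\<open>marginal h S\<^sub>2 S\<^sub>1\<close> is the marginal value $h(S_2 \mid S_1)$.\<close>

definition marginal :: "('a list \<Rightarrow> real) \<Rightarrow> 'a list \<Rightarrow> 'a list \<Rightarrow> real" where
  "marginal h S\<^sub>2 S\<^sub>1 = h (S\<^sub>1 \<oplus> S\<^sub>2) - h S\<^sub>1"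

definition forward_monotone :: "'a set \<Rightarrow> ('a list \<Rightarrow> real) \<Rightarrow> bool" where
  "forward_monotone V h \<longleftrightarrow> (\<forall>S\<^sub>1 \<in> seqs V. \<forall>S\<^sub>2 \<in> seqs V. h (S\<^sub>1 \<oplus> S\<^sub>2) \<ge> h S\<^sub>1)"

definition backward_monotone :: "'a set \<Rightarrow> ('a list \<Rightarrow> real) \<Rightarrow> bool" where
  "backward_monotone V h \<longleftrightarrow> (\<forall>S\<^sub>1 \<in> seqs V. \<forall>S\<^sub>2 \<in> seqs V. h (S\<^sub>1 \<oplus> S\<^sub>2) \<ge> h S\<^sub>2)"

definition sequence_submodular :: "'a set \<Rightarrow> ('a list \<Rightarrow> real) \<Rightarrow> bool" where
  "sequence_submodular V h \<longleftrightarrow>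
     (\<forall>S\<^sub>1 \<in> seqs V. \<forall>S\<^sub>2 \<in> seqs V. \<forall>S\<^sub>3 \<in> seqs V.
        seq_prefix V S\<^sub>1 S\<^sub>2 \<longrightarrow> marginal h S\<^sub>3 S\<^sub>1 \<ge> marginal h S\<^sub>3 S\<^sub>2)"

text \<open>The states reachable by the loop that starts with the empty sequence and, while it has
  fewer than \<open>m\<close> elements, appends a maximiser of the marginal value among the unused elements
  of the pool \<open>W\<close>. Ties are broken arbitrarily, hence a relation rather than a function.\<close>

inductive greedy_reach :: "('a list \<Rightarrow> real) \<Rightarrow> 'a set \<Rightarrow> nat \<Rightarrow> 'a list \<Rightarrow> bool"
  for h :: "'a list \<Rightarrow> real" and W :: "'a set" and m :: nat where
  start: "greedy_reach h W m []"
| step: "greedy_reach h W m S \<Longrightarrow> length S < m \<Longrightarrow>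
         is_arg_max (\<lambda>v. marginal h [v] S) (\<lambda>v. v \<in> W - set S) v \<Longrightarrow>
         greedy_reach h W m (S \<oplus> [v])"

definition greedy_output :: "('a list \<Rightarrow> real) \<Rightarrow> 'a set \<Rightarrow> nat \<Rightarrow> 'a list \<Rightarrow> bool" where
  "greedy_output h W m S \<longleftrightarrow> greedy_reach h W m S \<and> \<not> length S < m"

definition algorithm1_output ::
    "'a set \<Rightarrow> ('a list \<Rightarrow> real) \<Rightarrow> nat \<Rightarrow> nat \<Rightarrow> 'a list \<Rightarrow> bool" where
  "algorithm1_output V h k \<tau> S \<longleftrightarrow>
     (\<exists>S\<^sub>1 S\<^sub>2. greedy_output h V \<tau> S\<^sub>1 \<and> greedy_output h (V - set S\<^sub>1) (k - \<tau>) S\<^sub>2 \<and>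
              S = S\<^sub>1 \<oplus> S\<^sub>2)"

definition OPT :: "'a set \<Rightarrow> ('a list \<Rightarrow> real) \<Rightarrow> nat \<Rightarrow> nat \<Rightarrow> real" where
  "OPT V h k \<tau> =
     Max ((\<lambda>S. Min ((\<lambda>U. h (S \<ominus> U)) ` {U. U \<subseteq> set S \<and> card U \<le> \<tau>}))
          ` {S \<in> seqs V. length S \<le> k})"

definition consecutive_in :: "'a list \<Rightarrow> 'a set \<Rightarrow> bool" where
  "consecutive_in S Z \<longleftrightarrow> (\<exists>i j. i \<le> j \<and> j \<le> length S \<and> Z = (\<lambda>p. S ! p) ` {i..<j})"

end

theory Submission
  imports Defs
begin

text \<open>Deleting the window \<open>Z\<close> of \<open>\<tau>\<close> consecutive elements from \<open>S = S\<^sub>1 @ S\<^sub>2\<close>, with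
  \<open>|S\<^sub>1| = \<tau>\<close>, leaves \<open>A @ P @ B\<close>, where \<open>A\<close> is a prefix of \<open>S\<^sub>1\<close>, \<open>S\<^sub>2 = P @ Q @ B\<close>, and \<open>Q\<close> has
  the same length as \<open>A\<close>. Submodularity gives \<open>h S\<^sub>2 \<le> h (P @ B) + h Q\<close>. As \<open>A\<close> is greedy,
  \<open>h Q \<le> e / (e - 1) * h A\<close>, so \<open>h S\<^sub>2 \<le> (1 + e / (e - 1)) * h (S \<ominus> Z)\<close>. Deleting from an optimal
  sequence its elements in \<open>S\<^sub>1\<close> (and further ones, \<open>\<tau>\<close> in total) leaves a competitor for the
  greedy sequence \<open>S\<^sub>2\<close>, so \<open>h S\<^sub>2 \<ge> (1 - 1 / e) * OPT\<close>. This is the first bound. For the second,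
  compare \<open>h (S \<ominus> Z)\<close> with the value \<open>y\<close> of the first \<open>\<tau>\<close> elements of \<open>S\<^sub>2\<close>: the remaining
  \<open>k - 2\<tau>\<close> greedy steps shrink the gap \<open>OPT - y\<close> by the factor \<open>exp ((k - 2\<tau>) / (k - \<tau>))\<close>, and
  also \<open>h Q \<le> e / (e - 1) * y\<close>.\<close>

section \<open>Sequence concatenation and deletion of a window\<close>

lemma seq_concat_Nil [simp]: "S \<oplus> [] = S" "[] \<oplus> S = S"
  by (simp_all add: seq_concat_def seq_minus_def)

lemma set_seq_concat [simp]: "set (S \<oplus> T) = set S \<union> set T"
  by (auto simp: seq_concat_def seq_minus_def)

lemma seq_concat_disjoint: "set S \<inter> set T = {} \<Longrightarrow> S \<oplus> T = S @ T"
  by (auto simp: seq_concat_def seq_minus_def filter_id_conv)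

lemma seq_concat_in_seqs: "S \<in> seqs V \<Longrightarrow> T \<in> seqs V \<Longrightarrow> S \<oplus> T \<in> seqs V"
  by (auto simp: seqs_def seq_concat_def seq_minus_def)

lemma seq_concat_append: "distinct (T @ U) \<Longrightarrow> S \<oplus> (T @ U) = (S \<oplus> T) \<oplus> U"
  by (auto simp: seq_concat_def seq_minus_def intro!: filter_cong)

lemma seqs_appendD: "S @ T \<in> seqs V \<Longrightarrow> S \<in> seqs V \<and> T \<in> seqs V \<and> set S \<inter> set T = {}"
  by (auto simp: seqs_def)

lemma seqs_mono: "V \<subseteq> W \<Longrightarrow> S \<in> seqs V \<Longrightarrow> S \<in> seqs W"
  by (auto simp: seqs_def)

lemma seq_minus_infix:
  assumes "distinct (S @ D @ T)"
  shows "(S @ D @ T) \<ominus> set D = S @ T"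
proof -
  have "filter (\<lambda>v. v \<notin> set D) S = S" "filter (\<lambda>v. v \<notin> set D) T = T"
    using assms by (auto simp: filter_id_conv)
  then show ?thesis by (simp add: seq_minus_def)
qed

lemma seq_minus_window:
  assumes "distinct S" and "i \<le> j" and "j \<le> length S"
  shows "S \<ominus> (\<lambda>p. S ! p) ` {i..<j} = take i S @ drop j S"
proof -
  have split: "S = take i S @ drop i (take j S) @ drop j S"
    using assms by (metis append_take_drop_id append_assoc min.absorb1 take_take)
  have window: "(\<lambda>p. S ! p) ` {i..<j} = set (drop i (take j S))"
  proof -
    have "(\<lambda>p. S ! p) ` {i..<j} = set (map ((!) S) [i..<j])" by simp
    also have "map ((!) S) [i..<j] = drop i (take j S)"
      using assms by (intro nth_equalityI) auto
    finally show ?thesis .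
  qed
  have "distinct (take i S @ drop i (take j S) @ drop j S)"
    using assms(1) by (simp only: flip: split)
  then have "(take i S @ drop i (take j S) @ drop j S) \<ominus> set (drop i (take j S))
      = take i S @ drop j S"
    by (rule seq_minus_infix)
  then show ?thesis
    by (simp only: window flip: split)
qed

section \<open>Structure of greedy runs\<close>

lemma greedy_reach_seqs: "greedy_reach h W m G \<Longrightarrow> G \<in> seqs W \<and> length G \<le> m"
proof (induction rule: greedy_reach.induct)
  case start
  then show ?case by (simp add: seqs_def)
next
  case (step S v)
  then have "v \<in> W - set S" by (simp add: is_arg_max_def)
  with step show ?case
    by (auto simp: seqs_def seq_concat_disjoint)
qed

text \<open>Recovers every past choice from the finished run, so that later arguments can go by
  position instead of by rule induction.\<close>

lemma greedy_reach_arg_max: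
  assumes "greedy_reach h W m G" and "i < length G"
  shows "is_arg_max (\<lambda>v. marginal h [v] (take i G)) (\<lambda>v. v \<in> W - set (take i G)) (G ! i)"
  using assms
proof (induction rule: greedy_reach.induct)
  case start
  then show ?case by simp
next
  case (step S v)
  then have "v \<notin> set S" by (simp add: is_arg_max_def)
  then have eq: "S \<oplus> [v] = S @ [v]" by (simp add: seq_concat_disjoint)
  show ?case
  proof (cases "i < length S")
    case True
    then show ?thesis using step eq by (simp add: nth_append)
  next
    case False
    then have "i = length S" using step eq by simp
    then show ?thesis using step eq by simp
  qed
qed

section \<open>Monotonicity, submodularity and greedy growth\<close>

locale monotone_submodular =
  fixes V :: "'a set" and h :: "'a list \<Rightarrow> real"
  assumes forward: "forward_monotone V h"
    and backward: "backward_monotone V h"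
    and submodular: "sequence_submodular V h"
    and nonneg: "S \<in> seqs V \<Longrightarrow> h S \<ge> 0"
    and empty: "h [] = 0"
begin

lemma append_ge_left: "S @ T \<in> seqs V \<Longrightarrow> h S \<le> h (S @ T)"
  using forward seqs_appendD[of S T V] unfolding forward_monotone_def
  by (metis seq_concat_disjoint)

lemma append_ge_right: "S @ T \<in> seqs V \<Longrightarrow> h T \<le> h (S @ T)"
  using backward seqs_appendD[of S T V] unfolding backward_monotone_def
  by (metis seq_concat_disjoint)

lemma marginal_antimono:
  assumes "S \<in> seqs V" "T \<in> seqs V" "U \<in> seqs V"
  shows "marginal h U (S \<oplus> T) \<le> marginal h U S"
  using submodular assms seq_concat_in_seqs[OF assms(1,2)]
  unfolding sequence_submodular_def seq_prefix_def by blast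

lemma append_submodular:
  assumes "S @ T @ U \<in> seqs V"
  shows "h (S @ T @ U) - h (S @ T) \<le> h (S @ U) - h S"
proof -
  have "S \<in> seqs V" "T \<in> seqs V" "U \<in> seqs V"
    and "set S \<inter> set T = {}" "set (S @ T) \<inter> set U = {}" "set S \<inter> set U = {}"
    using assms by (auto simp: seqs_def)
  then show ?thesis
    using marginal_antimono[of S T U] seq_concat_disjoint[of "S @ T" U]
    by (simp add: marginal_def seq_concat_disjoint)
qed

text \<open>Submodularity twice: \<open>B\<close> gains no more after \<open>P @ Q\<close> than
  after \<open>P\<close>, and \<open>Q\<close> no more after \<open>P\<close> than after the empty
  sequence.\<close>

lemma delete_infix_loss:
  assumes "P @ Q @ B \<in> seqs V"
  shows "h (P @ Q @ B) \<le> h (P @ B) + h Q"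
proof -
  have "[] @ P @ Q \<in> seqs V" using assms by (auto simp: seqs_def)
  from append_submodular[OF this] append_submodular[OF assms] show ?thesis
    by (simp add: empty)
qed

text \<open>Add \<open>T\<close> element by element: each marginal is taken after an extension of
  \<open>G\<close>, hence is at most the one at \<open>G\<close>.\<close>

lemma concat_le_max_marginal:
  assumes "G \<in> seqs V" and "\<And>v. v \<in> set T \<Longrightarrow> marginal h [v] G \<le> \<Delta>" and "T \<in> seqs V"
  shows "h (G \<oplus> T) \<le> h G + real (length T) * \<Delta>"
  using assms(2,3)
proof (induction T rule: rev_induct)
  case Nil
  then show ?case by simp
next
  case (snoc v T)
  then have T: "T \<in> seqs V" and v: "[v] \<in> seqs V" by (auto simp: seqs_def)
  have "h (G \<oplus> (T @ [v])) = h (G \<oplus> T) + marginal h [v] (G \<oplus> T)"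
    using snoc.prems(2) by (subst seq_concat_append) (auto simp: seqs_def marginal_def)
  moreover have "marginal h [v] (G \<oplus> T) \<le> \<Delta>"
    using marginal_antimono[OF assms(1) T v] snoc.prems(1)[of v] by simp
  moreover have "h (G \<oplus> T) \<le> h G + real (length T) * \<Delta>"
    using snoc T by simp
  ultimately show ?case by (simp add: algebra_simps)
qed

text \<open>By backward monotonicity, \<open>T\<close> is worth no more than the current prefix
  followed by \<open>T\<close>, which exceeds the prefix by at most \<open>n\<close> times the
  greedy gain. So one step closes a fraction 1/n of the gap, and 1 - 1/n \<le> exp (-1/n).\<close>

lemma greedy_step_gap:
  assumes G: "greedy_reach h W m G" and "W \<subseteq> V" and i: "i < length G"
    and T: "T \<in> seqs W" and "length T \<le> n" and "n > 0"
  shows "exp (1 / real n) * (h T - h (take (Suc i) G)) \<le> h T - h (take i G)"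
proof -
  let ?G = "take i G" and ?v = "G ! i"
  let ?\<Delta> = "h (take (Suc i) G) - h ?G"
  have GV: "G \<in> seqs V" and TV: "T \<in> seqs V"
    using greedy_reach_seqs[OF G] T assms(2) seqs_mono by blast+
  have suc: "take (Suc i) G = ?G @ [?v]" by (rule take_Suc_conv_app_nth[OF i])
  have GiV: "?G @ [?v] \<in> seqs V"
    using GV suc by (metis append_take_drop_id seqs_appendD)
  note Gi = seqs_appendD[OF GiV]
  have \<Delta>: "?\<Delta> = marginal h [?v] ?G"
    using Gi by (simp add: suc marginal_def seq_concat_disjoint)
  have \<Delta>0: "?\<Delta> \<ge> 0"
    using append_ge_left[OF GiV] by (simp add: suc)
  have "marginal h [v] ?G \<le> ?\<Delta>" if "v \<in> set T" for v
  \<comment> \<open>An element already picked is no candidate for the greedy choice, but its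
    marginal is 0.\<close>
  proof (cases "v \<in> set ?G")
    case True
    then have "?G \<oplus> [v] = ?G" by (simp add: seq_concat_def seq_minus_def)
    then show ?thesis using \<Delta>0 by (simp add: marginal_def)
  next
    case False
    then show ?thesis
      using greedy_reach_arg_max[OF G i] that T
      unfolding \<Delta> is_arg_max_linorder seqs_def by blast
  qed
  then have "h (?G \<oplus> T) \<le> h ?G + real (length T) * ?\<Delta>"
    using concat_le_max_marginal Gi TV by blast
  also have "\<dots> \<le> h ?G + real n * ?\<Delta>"
    using assms(5) \<Delta>0 by (intro add_left_mono mult_right_mono) auto
  finally have gap: "h T - h ?G \<le> real n * ?\<Delta>"
    using backward Gi TV unfolding backward_monotone_def by fastforce
  show ?thesis
  \<comment> \<open>The exponential estimate needs a nonnegative gap. Once greedy has caught up with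
    \<open>T\<close>, a factor of at least 1 only lowers the left side.\<close>
  proof (cases "h T \<le> h (take (Suc i) G)")
    case True
    then have "exp (1 / real n) * (h T - h (take (Suc i) G)) \<le> 1 * (h T - h (take (Suc i) G))"
      by (intro mult_right_mono_neg) auto
    then show ?thesis using \<Delta>0 by simp
  next
    case False
    have "h T - h (take (Suc i) G) \<le> (1 - 1 / real n) * (h T - h ?G)"
      using gap assms(6) by (simp add: field_simps)
    also have "\<dots> \<le> exp (- (1 / real n)) * (h T - h ?G)"
      using False \<Delta>0 exp_ge_add_one_self[of "- (1 / real n)"] by (intro mult_right_mono) auto
    finally show ?thesis by (simp add: exp_minus field_simps)
  qed
qed

text \<open>Iterates the one-step estimate. The start \<open>i\<close> is free because the second
  bound starts counting after \<tau> picks.\<close>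

lemma greedy_gap:
  assumes "greedy_reach h W m G" and "W \<subseteq> V" and "i + j \<le> length G"
    and "T \<in> seqs W" and "length T \<le> n" and "n > 0"
  shows "exp (real j / real n) * (h T - h (take (i + j) G)) \<le> h T - h (take i G)"
  using assms(3)
proof (induction j)
  case 0
  then show ?case by simp
next
  case (Suc j)
  have "exp (real (Suc j) / real n) * (h T - h (take (i + Suc j) G))
      = exp (real j / real n) * (exp (1 / real n) * (h T - h (take (Suc (i + j)) G)))"
    by (simp add: add_divide_distrib exp_add)
  also have "\<dots> \<le> exp (real j / real n) * (h T - h (take (i + j) G))"
    using greedy_step_gap[OF assms(1,2) _ assms(4-6), of "i + j"] Suc.prems
    by (intro mult_left_mono) auto
  also have "\<dots> \<le> h T - h (take i G)" using Suc by simp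
  finally show ?case .
qed

text \<open>With \<open>n\<close> steps from the empty prefix the gap estimate reads e * (h T - g)
  \<le> h T, where g is the value of the prefix; solve for \<open>h T\<close>.\<close>

lemma greedy_prefix_ratio:
  assumes "greedy_reach h W m G" and "W \<subseteq> V" and "n \<le> length G"
    and "T \<in> seqs W" and "length T \<le> n"
  shows "h T \<le> exp 1 / (exp 1 - 1) * h (take n G)"
proof (cases "n = 0")
  case True
  then show ?thesis using assms(5) by (simp add: empty)
next
  case False
  have "(exp 1 :: real) > 1" by simp
  then show ?thesis
    using greedy_gap[OF assms(1,2) _ assms(4,5), of 0 n] assms(3) False
    by (simp add: empty field_simps)
qed

lemma
  assumes "finite V"
  shows OPT_nonneg: "OPT V h k \<tau> \<ge> 0"
    and OPT_le_avoiding: "length S\<^sub>1 = \<tau> \<Longrightarrow> \<tau> \<le> k \<Longrightarrow>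
      \<exists>T \<in> seqs (V - set S\<^sub>1). length T \<le> k - \<tau> \<and> OPT V h k \<tau> \<le> h T"
proof -
  let ?worst = "\<lambda>S. Min ((\<lambda>U. h (S \<ominus> U)) ` {U. U \<subseteq> set S \<and> card U \<le> \<tau>})"
  have "finite {S. set S \<subseteq> V \<and> length S \<le> k}"
    using assms by (rule finite_lists_length_le)
  then have fin: "finite {S \<in> seqs V. length S \<le> k}"
    by (rule rev_finite_subset) (auto simp: seqs_def)
  moreover have "[] \<in> {S \<in> seqs V. length S \<le> k}" by (simp add: seqs_def)
  ultimately have "OPT V h k \<tau> \<in> ?worst ` {S \<in> seqs V. length S \<le> k}"
    unfolding OPT_def by (intro Max_in) auto
  then obtain S where S: "S \<in> seqs V" "length S \<le> k" and opt: "OPT V h k \<tau> = ?worst S"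
    by auto
  have finU: "finite {U. U \<subseteq> set S \<and> card U \<le> \<tau>}"
    by (rule finite_subset[of _ "Pow (set S)"]) auto
  have "?worst S \<in> (\<lambda>U. h (S \<ominus> U)) ` {U. U \<subseteq> set S \<and> card U \<le> \<tau>}"
    using finU by (intro Min_in) (auto intro!: exI[of _ "{}"])
  moreover have "S \<ominus> U \<in> seqs V" for U
    using S by (auto simp: seqs_def seq_minus_def)
  ultimately show "OPT V h k \<tau> \<ge> 0"
    using nonneg opt by auto
  assume \<tau>: "length S\<^sub>1 = \<tau>" "\<tau> \<le> k"
  have card_S: "card (set S) = length S"
    using S by (simp add: seqs_def distinct_card)
  \<comment> \<open>Padding \<open>U\<close> beyond the common elements brings the length of the
    rest down to k - \<tau>; the minimum covers an \<open>S\<close> shorter than \<tau>.\<close>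
  have "\<exists>U. set S \<inter> set S\<^sub>1 \<subseteq> U \<and> U \<subseteq> set S \<and> card U = min \<tau> (length S)"
  proof (rule exists_subset_between)
    have "card (set S \<inter> set S\<^sub>1) \<le> card (set S\<^sub>1)" by (intro card_mono) auto
    moreover have "card (set S \<inter> set S\<^sub>1) \<le> card (set S)" by (intro card_mono) auto
    ultimately show "card (set S \<inter> set S\<^sub>1) \<le> min \<tau> (length S)"
      using card_length[of S\<^sub>1] \<tau> card_S by simp
  qed (auto simp: card_S)
  then obtain U where U: "set S \<inter> set S\<^sub>1 \<subseteq> U" "U \<subseteq> set S" "card U = min \<tau> (length S)"
    by blast
  have TV: "S \<ominus> U \<in> seqs (V - set S\<^sub>1)"
    using S U by (auto simp: seqs_def seq_minus_def)
  have "length (S \<ominus> U) = card (set S - U)"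
    using TV by (subst distinct_card[symmetric])
      (auto simp: seqs_def seq_minus_def intro!: arg_cong[of _ _ card])
  also have "\<dots> = length S - min \<tau> (length S)"
    using U card_S by (simp add: card_Diff_subset finite_subset)
  finally have "length (S \<ominus> U) \<le> k - \<tau>" using S by simp
  moreover have "OPT V h k \<tau> \<le> h (S \<ominus> U)"
    unfolding opt using finU U by (intro Min_le) auto
  ultimately show "\<exists>T \<in> seqs (V - set S\<^sub>1). length T \<le> k - \<tau> \<and> OPT V h k \<tau> \<le> h T"
    using TV by blast
qed

end

text \<open>Here \<open>s\<close> stands for the value of \<open>S\<^sub>2\<close>, \<open>x\<close>
  for that of the surviving sequence, \<open>y\<close> for that of the first \<tau> picks of
  \<open>S\<^sub>2\<close>, and \<open>f\<close> for the gap factor. The aim is to eliminate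
  \<open>s\<close> and \<open>y\<close>.\<close>

lemma ratio_arith:
  fixes e f x y s opt :: real
  assumes "e > 1" and "f \<ge> 1"
    and gap: "f * (opt - s) \<le> opt - y"
    and sx: "s \<le> x + e / (e - 1) * x" and sy: "s \<le> x + e / (e - 1) * y"
  shows "(e - 1) * (f - 1) / ((2 * e - 1) * f - (e - 1)) * opt \<le> x"
proof -
  define d where "d = e / (e - 1)"
  have d: "d > 1" "(e - 1) * d = e" using assms(1) by (auto simp: d_def)
  have fd: "f * d \<ge> 1" using mult_mono[of 1 f 1 d] assms(2) d by simp
  have key: "f * (opt - x - d * x) \<le> opt - x"
  proof (cases "x \<le> y")
    case True
    have "f * (opt - x - d * x) \<le> f * (opt - s)"
      using sx assms(2) by (intro mult_left_mono) (auto simp: d_def)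
    with gap True show ?thesis by simp
  next
    case False
    have "f * (opt - x - d * y) \<le> f * (opt - s)"
      using sy assms(2) by (intro mult_left_mono) (auto simp: d_def)
    \<comment> \<open>Since f * d \<ge> 1, replacing \<open>y\<close> by the larger \<open>x\<close>
      lowers the left side at least as much as the right.\<close>
    moreover have "(f * d - 1) * y \<le> (f * d - 1) * x"
      using False fd by (intro mult_left_mono) auto
    ultimately show ?thesis using gap by (simp add: algebra_simps)
  qed
  have "(e - 1) * (f * (opt - x - d * x)) \<le> (e - 1) * (opt - x)"
    using key assms(1) by (intro mult_left_mono) auto
  moreover have "(e - 1) * (f * (opt - x - d * x)) = f * ((e - 1) * (opt - x) - (e - 1) * d * x)"
    by (simp add: algebra_simps)
  ultimately have main: "(e - 1) * (f - 1) * opt \<le> ((2 * e - 1) * f - (e - 1)) * x"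
    unfolding d(2) by (simp add: algebra_simps)
  have "(2 * e - 1) * 1 \<le> (2 * e - 1) * f"
    using assms by (intro mult_left_mono) auto
  then have "(2 * e - 1) * f - (e - 1) > 0"
    using assms(1) by (simp add: algebra_simps)
  then show ?thesis using main by (simp add: divide_le_eq mult.commute)
qed

section \<open>Locating the window and deriving the two bounds\<close>

theorem theorem2:
  fixes V :: "'a set" and h :: "'a list \<Rightarrow> real" and k \<tau> :: nat and S :: "'a list" and Z :: "'a set"
  assumes "finite V"
    and "k \<ge> 2" and "1 \<le> \<tau>" and "\<tau> \<le> k" and "card V \<ge> k"
    and "\<forall>S \<in> seqs V. h S \<ge> 0"
    and "h [] = 0"
    and "forward_monotone V h"
    and "backward_monotone V h"
    and "sequence_submodular V h"
    and "algorithm1_output V h k \<tau> S"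
    and "Z \<subseteq> set S" and "card Z = \<tau>" and "consecutive_in S Z"
  shows "h (S \<ominus> Z) \<ge> (exp 1 - 1)\<^sup>2 / (exp 1 * (2 * exp 1 - 1)) * OPT V h k \<tau> \<and>
    (\<tau> < k \<and> (2 * exp 1 - 1) * exp ((real k - 2 * real \<tau>) / (real k - real \<tau>)) - (exp 1 - 1) > 0 \<longrightarrow>
      h (S \<ominus> Z) \<ge>
        ((exp 1 - 1) * (exp ((real k - 2 * real \<tau>) / (real k - real \<tau>)) - 1)) /
        ((2 * exp 1 - 1) * exp ((real k - 2 * real \<tau>) / (real k - real \<tau>)) - (exp 1 - 1))
        * OPT V h k \<tau>)"
proof -
  interpret monotone_submodular V h
    using assms by unfold_locales auto
  obtain S\<^sub>1 S\<^sub>2 where G1: "greedy_reach h V \<tau> S\<^sub>1" and G2: "greedy_reach h (V - set S\<^sub>1) (k - \<tau>) S\<^sub>2"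
    and len: "length S\<^sub>1 = \<tau>" "length S\<^sub>2 = k - \<tau>" and S: "S = S\<^sub>1 \<oplus> S\<^sub>2"
    using assms(11) unfolding algorithm1_output_def greedy_output_def
    by (metis greedy_reach_seqs le_neq_implies_less)
  have sub: "V - set S\<^sub>1 \<subseteq> V" by blast
  have S1: "S\<^sub>1 \<in> seqs V" and S2: "S\<^sub>2 \<in> seqs (V - set S\<^sub>1)"
    using greedy_reach_seqs[OF G1] greedy_reach_seqs[OF G2] by auto
  have S_app: "S = S\<^sub>1 @ S\<^sub>2"
    using S S2 by (subst S, intro seq_concat_disjoint) (auto simp: seqs_def)
  have SV: "S\<^sub>1 @ S\<^sub>2 \<in> seqs V" using S1 S2 by (auto simp: seqs_def)
  obtain i j where ij: "i \<le> j" "j \<le> length S" and Z: "Z = (\<lambda>p. S ! p) ` {i..<j}"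
    using assms(14) unfolding consecutive_in_def by blast
  have "inj_on (\<lambda>p. S ! p) {i..<j}"
    using SV S_app ij by (intro inj_on_nth) (auto simp: seqs_def)
  then have j: "j = i + \<tau>" using assms(13) ij Z by (simp add: card_image)
  then have i: "i \<le> length S\<^sub>2" using ij S_app len by simp
  \<comment> \<open>Truncated subtraction covers both positions of the window: for i \<le> \<tau>,
    \<open>P\<close> is empty; for i \<ge> \<tau>, \<open>A\<close> is all of
    \<open>S\<^sub>1\<close>.\<close>
  define A P Q B where "A = take i S\<^sub>1" and "P = take (i - \<tau>) S\<^sub>2"
    and "Q = drop (i - \<tau>) (take i S\<^sub>2)" and "B = drop i S\<^sub>2"
  have S2_split: "S\<^sub>2 = P @ Q @ B"
    unfolding P_def Q_def B_def
    by (metis append_assoc append_take_drop_id diff_le_self min.absorb1 take_take)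
  have S1_split: "S\<^sub>1 = A @ drop i S\<^sub>1" by (simp add: A_def)
  have "S \<ominus> Z = take i S @ drop j S"
    unfolding Z using ij SV S_app by (intro seq_minus_window) (auto simp: seqs_def)
  also have "\<dots> = A @ P @ B"
    by (simp add: S_app j len A_def P_def B_def)
  finally have SZ: "S \<ominus> Z = A @ P @ B" .
  have "(A @ drop i S\<^sub>1) @ (P @ Q @ B) \<in> seqs V" using SV by (simp only: flip: S1_split S2_split)
  then have APB: "A @ P @ B \<in> seqs V" and PQB: "P @ Q @ B \<in> seqs V"
    unfolding seqs_def by auto
  define x where "x = h (S \<ominus> Z)"
  have x0: "x \<ge> 0" unfolding x_def SZ using APB by (rule nonneg)
  have xA: "h A \<le> x" unfolding x_def SZ using APB by (rule append_ge_left)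
  have xPB: "h (P @ B) \<le> x" unfolding x_def SZ using APB by (rule append_ge_right)
  have Q: "Q \<in> seqs (V - set S\<^sub>1)" using S2 S2_split by (auto simp: seqs_def)
  have lenQ: "length Q = min i \<tau>" using i by (auto simp: Q_def)
  \<comment> \<open>The first phase chooses from all of \<open>V\<close>, so \<open>Q\<close>
    competes with its first \<open>length Q\<close> picks, which form \<open>A\<close>.\<close>
  have "h Q \<le> exp 1 / (exp 1 - 1) * h (take (min i \<tau>) S\<^sub>1)"
    using greedy_prefix_ratio[OF G1, of "min i \<tau>" Q] Q lenQ len seqs_mono[OF sub] by simp
  also have "take (min i \<tau>) S\<^sub>1 = A" by (simp add: A_def len min_def)
  also have "exp 1 / (exp 1 - 1) * h A \<le> exp 1 / (exp 1 - 1) * x"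
    using xA by (intro mult_left_mono) auto
  finally have Qx: "h Q \<le> exp 1 / (exp 1 - 1) * x" .
  have S2_le: "h S\<^sub>2 \<le> x + h Q"
    using delete_infix_loss[OF PQB] xPB S2_split by simp
  obtain T where T: "T \<in> seqs (V - set S\<^sub>1)" "length T \<le> k - \<tau>" and opt: "OPT V h k \<tau> \<le> h T"
    using OPT_le_avoiding[OF assms(1) len(1) assms(4)] by blast
  have opt0: "OPT V h k \<tau> \<ge> 0" using assms(1) by (rule OPT_nonneg)
  have e1: "(exp 1 :: real) > 1" by simp

  have "h T \<le> exp 1 / (exp 1 - 1) * h S\<^sub>2"
    using greedy_prefix_ratio[OF G2 sub _ T] len by simp
  then have "(exp 1 - 1) * h T \<le> exp 1 * h S\<^sub>2"
    using e1 by (simp add: field_simps)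
  then have "(exp 1 - 1) * ((exp 1 - 1) * OPT V h k \<tau>) \<le> (exp 1 - 1) * (exp 1 * h S\<^sub>2)"
    using opt e1 by (intro mult_left_mono) (auto intro: order_trans[OF mult_left_mono])
  also have "\<dots> \<le> (exp 1 - 1) * (exp 1 * (x + exp 1 / (exp 1 - 1) * x))"
    using S2_le Qx e1 by (intro mult_left_mono) auto
  \<comment> \<open>1 + e/(e - 1) = (2e - 1)/(e - 1), whose denominator cancels the factor in
    front.\<close>
  also have "\<dots> = exp 1 * (2 * exp 1 - 1) * x"
    using e1 by (simp add: field_simps)
  finally have "(exp 1 - 1)\<^sup>2 * OPT V h k \<tau> \<le> exp 1 * (2 * exp 1 - 1) * x"
    by (simp add: power2_eq_square mult.assoc)
  moreover have "exp 1 * (2 * exp 1 - 1) > (0::real)"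
    using e1 by (intro mult_pos_pos) linarith+
  ultimately have first: "(exp 1 - 1)\<^sup>2 / (exp 1 * (2 * exp 1 - 1)) * OPT V h k \<tau> \<le> x"
    by (simp add: divide_le_eq mult.commute)

  define f where "f = exp ((real k - 2 * real \<tau>) / (real k - real \<tau>))"
  have second: "(exp 1 - 1) * (f - 1) / ((2 * exp 1 - 1) * f - (exp 1 - 1)) * OPT V h k \<tau> \<le> x"
    if \<tau>: "\<tau> < k" and pos: "(2 * exp 1 - 1) * f - (exp 1 - 1) > 0"
  proof (cases "2 * \<tau> \<le> k")
    case True
    let ?y = "h (take \<tau> S\<^sub>2)"
    have "real (k - 2 * \<tau>) / real (k - \<tau>) = (real k - 2 * real \<tau>) / (real k - real \<tau>)"
      using True \<tau> by (simp add: of_nat_diff)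
    then have gap: "f * (h T - h S\<^sub>2) \<le> h T - ?y"
      using greedy_gap[OF G2 sub _ T, of \<tau> "k - 2 * \<tau>"] True \<tau> len
      by (simp add: f_def)
    have f1: "f \<ge> 1" using True \<tau> by (simp add: f_def)
    \<comment> \<open>Lowering \<open>h T\<close> to the optimum reduces the left side
      \<open>f\<close> times as much as the right, and f \<ge> 1.\<close>
    have "f * (OPT V h k \<tau> - h S\<^sub>2) \<le> OPT V h k \<tau> - ?y"
      using gap mult_right_mono[OF f1, of "h T - OPT V h k \<tau>"] opt by (simp add: algebra_simps)
    moreover have "h Q \<le> exp 1 / (exp 1 - 1) * ?y"
      using greedy_prefix_ratio[OF G2 sub _ Q, of \<tau>] lenQ len True by simp
    ultimately show ?thesis
      using ratio_arith[OF e1 f1] S2_le Qx by force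
  next
    case False
    \<comment> \<open>The exponent is negative here, so over the positive denominator the
      coefficient is nonpositive and the bound follows from x \<ge> 0.\<close>
    then have "f \<le> 1" using \<tau> by (simp add: f_def divide_le_0_iff)
    then have "(exp 1 - 1) * (f - 1) / ((2 * exp 1 - 1) * f - (exp 1 - 1)) \<le> 0"
      using pos e1 by (simp add: divide_le_0_iff mult_le_0_iff)
    then show ?thesis using opt0 x0 by (meson mult_nonpos_nonneg order_trans)
  qed
  show ?thesis
    using first second unfolding x_def f_def by blast
qed

end
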